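(* For every even positive integer $a$, there exists a structured $(a,1)$ knight's tour in $[6a+2]^2$.
   Context: $[N]=\{0,\dots,N-1\}$. The $(a,1)$ knight's graph on $[N]^2$ has vertex set $[N]^2$, with $(x,y)\sim(x',y')$ iff $\{|x-x'|,|y-y'|\}=\{a,1\}$; an $(a,1)$ knight's tour is a Hamiltonian cycle of this graph. It is structured if it contains every edge $\{(i,j),(i+a,\,j+(-1)^j)\}$ with $i,j\in\{0,\dots,a-1\}$. *)

theory Defs
  imports Main
begin

definition board :: "nat \<Rightarrow> (int \<times> int) set" where
  "board N = {0..<int N} \<times> {0..<int N}"

definition knight_edges :: "nat \<Rightarrow> nat \<Rightarrow> (int \<times> int) set set" where
  "knight_edges a N =
     {{(x, y), (x', y')} | x y x' y'.
        (x, y) \<in> board N \<and> (x', y') \<in> board N \<and>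
        {\<bar>x - x'\<bar>, \<bar>y - y'\<bar>} = {int a, 1}}"

text \<open>A cycle in a simple graph is represented by the list of its vertices in cyclic order,
  starting anywhere and in either direction.\<close>

definition cycle_edges :: "'a list \<Rightarrow> 'a set set" where
  "cycle_edges vs = {{vs ! k, vs ! (Suc k mod length vs)} | k. k < length vs}"

definition hamiltonian_cycle :: "'a set \<Rightarrow> 'a set set \<Rightarrow> 'a list \<Rightarrow> bool" where
  "hamiltonian_cycle V E vs \<longleftrightarrow>
     3 \<le> length vs \<and> distinct vs \<and> set vs = V \<and> cycle_edges vs \<subseteq> E"

definition knight_tour :: "nat \<Rightarrow> nat \<Rightarrow> (int \<times> int) list \<Rightarrow> bool" where
  "knight_tour a N vs \<longleftrightarrow> hamiltonian_cycle (board N) (knight_edges a N) vs"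

definition structured :: "nat \<Rightarrow> (int \<times> int) list \<Rightarrow> bool" where
  "structured a vs \<longleftrightarrow>
     (\<forall>i<a. \<forall>j<a.
        {(int i, int j), (int i + int a, int j + (- 1) ^ j)} \<in> cycle_edges vs)"

end

theory Submission
  imports Defs
begin

text \<open>
  Put \<open>a = 2 * h\<close>. For \<open>i, j < a\<close> the map
  \<open>(X, Y) \<mapsto> (a * X + 2 * i + Y mod 2, a * Y + 2 * j + X mod 2)\<close> turns unit steps of the integer
  lattice into knight's moves, and the images of these maps partition the lattice. The board cuts
  every image down to a rectangular grid with sides \<open>6\<close> or \<open>7\<close>. For fixed \<open>i\<close>, Hamiltonian paths of
  the grids \<open>j = 0, \<dots>, a - 1\<close> link up to a cycle: from \<open>(1, Y)\<close> in grid \<open>j\<close> a knight reaches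
  \<open>(0, Y)\<close> in grid \<open>j + 1\<close>, respectively \<open>(0, Y + 2)\<close> in grid \<open>0\<close> if \<open>j = a - 1\<close>. These \<open>a\<close> disjoint
  cycles are merged one after the other: the edge \<open>(2, 3)--(3, 3)\<close> of grid \<open>(i, 0)\<close> and the edge
  \<open>(2, 2)--(3, 2)\<close> of grid \<open>(i + 1, 0)\<close> are opposite sides of a 4-cycle of knight's moves and are
  traded for its other two sides. The structured edges sit in the corners of the grids, where the
  paths must use them; they survive because the merging happens in the columns \<open>x \<ge> 2 * a\<close>.
\<close>

section \<open>Paths and cycles as vertex lists\<close>

fun path_edges :: "'a list \<Rightarrow> 'a set set" where
  "path_edges [] = {}"
| "path_edges (x # xs) = (if xs = [] then {} else insert {x, hd xs} (path_edges xs))"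

lemma path_edges_append:
  assumes "xs \<noteq> []" "ys \<noteq> []"
  shows "path_edges (xs @ ys) = insert {last xs, hd ys} (path_edges xs \<union> path_edges ys)"
  using assms by (induction xs) auto

lemma path_edges_map: "path_edges (map f xs) = (`) f ` path_edges xs"
  by (induction xs) (auto simp: hd_map)

lemma path_edges_rev: "path_edges (rev xs) = path_edges xs"
  by (induction xs) (auto simp: path_edges_append last_rev)

lemma path_edges_subset_set: "e \<in> path_edges xs \<Longrightarrow> e \<subseteq> set xs"
  by (induction xs) (auto split: if_splits)

lemma path_edges_splitE:
  assumes "e \<in> path_edges xs"
  obtains ys zs where "xs = ys @ zs" "ys \<noteq> []" "zs \<noteq> []" "e = {last ys, hd zs}"
proof -
  have "\<exists>ys zs. xs = ys @ zs \<and> ys \<noteq> [] \<and> zs \<noteq> [] \<and> e = {last ys, hd zs}"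
    using assms
  proof (induction xs)
    case (Cons x xs)
    then consider (first) "xs \<noteq> []" "e = {x, hd xs}" | (later) "e \<in> path_edges xs"
      by (auto split: if_splits)
    then show ?case
    proof cases
      case first
      then show ?thesis by (intro exI[of _ "[x]"] exI[of _ xs]) simp
    next
      case later
      then obtain ys zs where "xs = ys @ zs" "ys \<noteq> []" "zs \<noteq> []" "e = {last ys, hd zs}"
        using Cons.IH by blast
      then show ?thesis by (intro exI[of _ "x # ys"] exI[of _ zs]) simp
    qed
  qed simp
  then show ?thesis using that by blast
qed

lemma path_edges_conv_nth: "path_edges xs = (\<lambda>k. {xs ! k, xs ! Suc k}) ` {..<length xs - 1}"
proof (induction xs)
  case (Cons x xs)
  show ?case
  proof (cases xs)
    case (Cons y ys)
    have "(\<lambda>k. {(x # xs) ! k, (x # xs) ! Suc k}) ` {..<Suc (length ys)} =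
        insert {x, y} ((\<lambda>k. {xs ! k, xs ! Suc k}) ` {..<length ys})"
      by (simp add: lessThan_Suc_eq_insert_0 image_image Cons)
    then show ?thesis
      using Cons.IH by (simp add: Cons)
  qed simp
qed simp

lemma cycle_edges_conv_path_edges:
  assumes "xs \<noteq> []"
  shows "cycle_edges xs = insert {last xs, hd xs} (path_edges xs)"
proof -
  have "{xs ! k, xs ! (Suc k mod length xs)} = {(xs @ [hd xs]) ! k, (xs @ [hd xs]) ! Suc k}"
    if "k < length xs" for k
    using that assms by (cases "Suc k = length xs") (auto simp: nth_append hd_conv_nth)
  then have "cycle_edges xs = path_edges (xs @ [hd xs])"
    unfolding cycle_edges_def path_edges_conv_nth by auto
  also have "\<dots> = insert {last xs, hd xs} (path_edges xs)"
    using assms by (simp add: path_edges_append)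
  finally show ?thesis .
qed

lemma cycle_edges_append:
  assumes "xs \<noteq> []" "ys \<noteq> []"
  shows "cycle_edges (xs @ ys) =
    {{last xs, hd ys}, {last ys, hd xs}} \<union> path_edges xs \<union> path_edges ys"
  using assms by (auto simp: cycle_edges_conv_path_edges path_edges_append)

lemma cycle_edges_rev: "cycle_edges (rev xs) = cycle_edges xs"
proof (cases "xs = []")
  case False
  then show ?thesis
    by (simp add: cycle_edges_conv_path_edges path_edges_rev hd_rev last_rev insert_commute)
qed simp

lemma hamiltonian_cycle_edge_subset:
  assumes "hamiltonian_cycle V E c" "e \<in> cycle_edges c"
  shows "e \<subseteq> V"
proof -
  have "c \<noteq> []" "set c = V" using assms(1) unfolding hamiltonian_cycle_def by auto
  then have "e \<in> insert {last c, hd c} (path_edges c)"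
    using assms(2) by (simp add: cycle_edges_conv_path_edges)
  then show ?thesis
    using path_edges_subset_set \<open>set c = V\<close> \<open>c \<noteq> []\<close> by fastforce
qed

lemma hamiltonian_cycle_edges_disjoint:
  assumes "hamiltonian_cycle V E c" "hamiltonian_cycle W E d" "V \<inter> W = {}"
  shows "cycle_edges c \<inter> cycle_edges d = {}"
proof -
  have "e \<noteq> {}" if "e \<in> cycle_edges c" for e
    using that unfolding cycle_edges_def by auto
  then show ?thesis
    using hamiltonian_cycle_edge_subset[OF assms(1)] hamiltonian_cycle_edge_subset[OF assms(2)]
      assms(3) by blast
qed

lemma hamiltonian_cycle_cutE:
  assumes "hamiltonian_cycle V E c" "{u, v} \<in> cycle_edges c"
  obtains c' where "hamiltonian_cycle V E c'" "cycle_edges c' = cycle_edges c"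
    "hd c' = v" "last c' = u"
proof -
  have "c \<noteq> []" using assms(1) unfolding hamiltonian_cycle_def by auto
  obtain r where r: "hamiltonian_cycle V E r" "cycle_edges r = cycle_edges c"
    "{u, v} = {last r, hd r}"
  proof (cases "{u, v} \<in> path_edges c")
    case True
    then obtain ys zs where split: "c = ys @ zs" "ys \<noteq> []" "zs \<noteq> []" "{u, v} = {last ys, hd zs}"
      by (rule path_edges_splitE)
    then have "cycle_edges (zs @ ys) = cycle_edges c"
      by (auto simp: cycle_edges_append)
    moreover from this have "hamiltonian_cycle V E (zs @ ys)"
      using assms(1) split(1) unfolding hamiltonian_cycle_def by auto
    ultimately show ?thesis using that[of "zs @ ys"] split by simp
  next
    case False
    then show ?thesis
      using that[of c] assms \<open>c \<noteq> []\<close> by (simp add: cycle_edges_conv_path_edges)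
  qed
  then have rev: "hamiltonian_cycle V E (rev r)"
    unfolding hamiltonian_cycle_def by (simp add: cycle_edges_rev)
  consider (same) "last r = u" "hd r = v" | (reversed) "last r = v" "hd r = u"
    using r(3) by (auto simp: doubleton_eq_iff)
  then show ?thesis
  proof cases
    case same
    then show ?thesis using that r by blast
  next
    case reversed
    then show ?thesis
      using that[of "rev r"] rev r(2) by (simp add: cycle_edges_rev hd_rev last_rev)
  qed
qed

section \<open>Merging disjoint cycles\<close>

lemma hamiltonian_cycle_merge:
  assumes c: "hamiltonian_cycle V E c" and d: "hamiltonian_cycle W E d" and "V \<inter> W = {}"
    and uv: "{u, v} \<in> cycle_edges c" and wz: "{w, z} \<in> cycle_edges d"
    and E: "{u, w} \<in> E" "{v, z} \<in> E"
  obtains m where "hamiltonian_cycle (V \<union> W) E m"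
    "cycle_edges c \<union> cycle_edges d - {{u, v}, {w, z}} \<subseteq> cycle_edges m"
proof -
  obtain c' where c': "hamiltonian_cycle V E c'" "cycle_edges c' = cycle_edges c"
    and c'_ends: "hd c' = v" "last c' = u"
    using hamiltonian_cycle_cutE[OF c uv] .
  have "{z, w} \<in> cycle_edges d" using wz by (simp add: insert_commute)
  from hamiltonian_cycle_cutE[OF d this]
  obtain d' where d': "hamiltonian_cycle W E d'" "cycle_edges d' = cycle_edges d"
    and d'_ends: "hd d' = w" "last d' = z" .
  have ne: "c' \<noteq> []" "d' \<noteq> []" using c'(1) d'(1) unfolding hamiltonian_cycle_def by auto
  have c_edges: "cycle_edges c = insert {u, v} (path_edges c')"
    and d_edges: "cycle_edges d = insert {w, z} (path_edges d')"
    using cycle_edges_conv_path_edges[OF ne(1)] cycle_edges_conv_path_edges[OF ne(2)]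
    by (simp_all add: c'(2) d'(2) c'_ends d'_ends insert_commute)
  have m_edges: "cycle_edges (c' @ d') = {{u, w}, {v, z}} \<union> path_edges c' \<union> path_edges d'"
    using ne by (simp add: cycle_edges_append c'_ends d'_ends insert_commute)
  have "hamiltonian_cycle (V \<union> W) E (c' @ d')"
    using c' d' \<open>V \<inter> W = {}\<close> E m_edges c_edges d_edges unfolding hamiltonian_cycle_def by auto
  then show ?thesis
    by (rule that) (auto simp: m_edges c_edges d_edges)
qed

lemma hamiltonian_cycle_merge_chain:
  fixes n :: nat
  assumes "\<And>i. i \<le> n \<Longrightarrow> hamiltonian_cycle (V i) E (c i)"
    and "\<And>i j. i < j \<Longrightarrow> j \<le> n \<Longrightarrow> V i \<inter> V j = {}"
    and "\<And>i. i < n \<Longrightarrow> {u i, v i} \<in> cycle_edges (c i)"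
    and "\<And>i. i < n \<Longrightarrow> {w (Suc i), z (Suc i)} \<in> cycle_edges (c (Suc i))"
    and "\<And>i. i < n \<Longrightarrow> {u i, v i} \<noteq> {w i, z i}"
    and "\<And>i. i < n \<Longrightarrow> {u i, w (Suc i)} \<in> E" "\<And>i. i < n \<Longrightarrow> {v i, z (Suc i)} \<in> E"
  shows "\<exists>m. hamiltonian_cycle (\<Union>i\<le>n. V i) E m \<and>
    (\<Union>i\<le>n. cycle_edges (c i)) - (\<Union>i<n. {{u i, v i}, {w (Suc i), z (Suc i)}})
      \<subseteq> cycle_edges m" (is "\<exists>m. ?merged n m \<and> _ - ?traded n \<subseteq> _ m")
  using assms
proof (induction n)
  case 0
  then show ?case by auto
next
  case (Suc n)
  note cycle = Suc.prems(1) and disjoint = Suc.prems(2) and out_edge = Suc.prems(3)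
    and in_edge = Suc.prems(4) and out_neq_in = Suc.prems(5) and E = Suc.prems(6,7)
  have "\<exists>m. ?merged n m \<and> (\<Union>i\<le>n. cycle_edges (c i)) - ?traded n \<subseteq> cycle_edges m"
    by (rule Suc.IH; rule Suc.prems; simp)
  then obtain m where m: "?merged n m"
    and m_edges: "(\<Union>i\<le>n. cycle_edges (c i)) - ?traded n \<subseteq> cycle_edges m"
    by blast
  have out_neq: "{u n, v n} \<noteq> e" if "e \<in> cycle_edges (c i)" "i < n" for e i
    using hamiltonian_cycle_edges_disjoint[OF cycle cycle disjoint, of i n] out_edge[of n] that
    by auto
  have "{u n, v n} \<noteq> {w (Suc i), z (Suc i)}" if "i < n" for i
    using that out_neq[OF in_edge] out_neq_in[of n] by (cases "Suc i = n") simp_all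
  then have "{u n, v n} \<notin> ?traded n"
    using out_neq[OF out_edge] by force
  then have out_in_m: "{u n, v n} \<in> cycle_edges m"
    using m_edges out_edge[of n] by auto
  have "(\<Union>i\<le>n. V i) \<inter> V (Suc n) = {}"
    using disjoint[of _ "Suc n"] by (auto simp: less_Suc_eq_le)
  with hamiltonian_cycle_merge[OF m cycle[of "Suc n"] _ out_in_m in_edge[of n]]
  obtain m' where "hamiltonian_cycle ((\<Union>i\<le>n. V i) \<union> V (Suc n)) E m'"
    and "cycle_edges m \<union> cycle_edges (c (Suc n)) - {{u n, v n}, {w (Suc n), z (Suc n)}}
      \<subseteq> cycle_edges m'"
    using E[of n] by blast
  moreover from this(2)
  have "(\<Union>i\<le>Suc n. cycle_edges (c i)) - ?traded (Suc n) \<subseteq> cycle_edges m'"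
    using m_edges unfolding atMost_Suc lessThan_Suc UN_insert by blast
  ultimately show ?case
    by (intro exI[of _ m']) (simp add: atMost_Suc Un_commute)
qed

section \<open>Concatenating paths to a cycle\<close>

lemma path_edges_concat_upt:
  assumes "\<And>k. k \<le> n \<Longrightarrow> f k \<noteq> []"
  shows "path_edges (concat (map f [0..<Suc n])) =
    (\<Union>k\<le>n. path_edges (f k)) \<union> (\<Union>k<n. {{last (f k), hd (f (Suc k))}})"
  using assms
proof (induction n)
  case (Suc n)
  have "path_edges (concat (map f [0..<Suc n]) @ f (Suc n)) =
      insert {last (f n), hd (f (Suc n))}
        (path_edges (concat (map f [0..<Suc n])) \<union> path_edges (f (Suc n)))"
    using Suc.prems by (subst path_edges_append) simp_all
  moreover have "path_edges (concat (map f [0..<Suc n])) =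
      (\<Union>k\<le>n. path_edges (f k)) \<union> (\<Union>k<n. {{last (f k), hd (f (Suc k))}})"
    using Suc by simp
  ultimately show ?case
    by (auto simp: atMost_Suc lessThan_Suc)
qed simp

lemma cycle_edges_concat_upt:
  assumes "0 < n" "\<And>k. k < n \<Longrightarrow> f k \<noteq> []"
  shows "cycle_edges (concat (map f [0..<n])) =
    (\<Union>k<n. path_edges (f k)) \<union> (\<Union>k<n. {{last (f k), hd (f (Suc k mod n))}})"
proof -
  obtain m where n: "n = Suc m" using assms(1) gr0_conv_Suc by blast
  have "(\<Union>k<m. {{last (f k), hd (f (Suc k))}}) = (\<Union>k<m. {{last (f k), hd (f (Suc k mod n))}})"
    by (intro SUP_cong) (simp_all add: n)
  moreover have "hd (concat (map f [0..<n])) = hd (f 0)"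
    using assms by (simp add: upt_conv_Cons)
  moreover have "last (concat (map f [0..<n])) = last (f m)"
    using assms(2) by (simp add: n)
  moreover have "concat (map f [0..<n]) \<noteq> []"
    using assms(2) by (simp add: n)
  ultimately show ?thesis
    using path_edges_concat_upt[of m f] assms(2)
    by (simp add: cycle_edges_conv_path_edges n lessThan_Suc_atMost[symmetric] lessThan_Suc
        del: upt_Suc)
qed

lemma distinct_concat_upt:
  assumes "\<And>k. k < n \<Longrightarrow> distinct (f k)"
    and "\<And>j k. j < k \<Longrightarrow> k < n \<Longrightarrow> set (f j) \<inter> set (f k) = {}"
  shows "distinct (concat (map f [0..<n]))"
  using assms
proof (induction n)
  case (Suc n)
  then have "distinct (concat (map f [0..<n]))" "distinct (f n)"
    by simp_all
  moreover have "set (f k) \<inter> set (f n) = {}" if "k < n" for k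
    using Suc.prems(2) that by simp
  ultimately show ?case by (auto simp: disjoint_iff)
qed simp

lemma hamiltonian_cycle_concat_upt:
  assumes "0 < n" "\<And>k. k < n \<Longrightarrow> f k \<noteq> []" "3 \<le> length (f 0)"
    and "\<And>k. k < n \<Longrightarrow> distinct (f k)"
    and "\<And>j k. j < k \<Longrightarrow> k < n \<Longrightarrow> set (f j) \<inter> set (f k) = {}"
    and "\<And>k. k < n \<Longrightarrow> path_edges (f k) \<subseteq> E"
    and "\<And>k. k < n \<Longrightarrow> {last (f k), hd (f (Suc k mod n))} \<in> E"
  shows "hamiltonian_cycle (\<Union>k<n. set (f k)) E (concat (map f [0..<n]))"
  unfolding hamiltonian_cycle_def
proof (intro conjI)
  show "3 \<le> length (concat (map f [0..<n]))"
    using assms(1,3) by (simp add: upt_conv_Cons)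
  show "distinct (concat (map f [0..<n]))"
    using assms(4,5) by (rule distinct_concat_upt)
  show "set (concat (map f [0..<n])) = (\<Union>k<n. set (f k))"
    by (simp add: atLeast0LessThan)
  show "cycle_edges (concat (map f [0..<n])) \<subseteq> E"
    using assms(1,2,6,7) by (subst cycle_edges_concat_upt) auto
qed

section \<open>Hamiltonian paths of small grids\<close>

definition step :: "char \<Rightarrow> int \<times> int \<Rightarrow> int \<times> int" where
  "step d = (\<lambda>(X, Y).
     if d = CHR ''E'' then (X + 1, Y) else if d = CHR ''W'' then (X - 1, Y)
     else if d = CHR ''N'' then (X, Y + 1) else (X, Y - 1))"

fun walk :: "int \<times> int \<Rightarrow> string \<Rightarrow> (int \<times> int) list" where
  "walk c [] = [c]"
| "walk c (d # ds) = c # walk (step d c) ds"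

lemma walk_nonempty: "walk c ds \<noteq> []"
  by (cases ds) simp_all

lemma hd_walk: "hd (walk c ds) = c"
  by (cases ds) simp_all

lemma path_edges_walk:
  assumes "e \<in> path_edges (walk c ds)"
  shows "\<exists>c' d. e = {c', step d c'}"
  using assms
proof (induction ds arbitrary: c)
  case (Cons d ds)
  then have "e = {c, step d c} \<or> e \<in> path_edges (walk (step d c) ds)"
    by (simp add: walk_nonempty hd_walk)
  then show ?case using Cons.IH by blast
qed simp

definition extent :: "bool \<Rightarrow> bool \<Rightarrow> int set" where
  "extent long shifted = {- of_bool shifted..5 + of_bool long - of_bool shifted}"

text \<open>Four flags describe a grid: it has \<open>7\<close> columns if \<open>wide\<close> holds and \<open>6\<close> otherwise, starting
  with column \<open>-1\<close> if \<open>left\<close> holds and with column \<open>0\<close> otherwise; \<open>tall\<close> and \<open>low\<close> do the same for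
  the rows. Its path runs from \<open>(0, entry_row)\<close> to \<open>(1, exit_row)\<close>. In a \<open>7 \<times> 7\<close> grid both ends must
  have the colour of the corners, so the row changes by an odd number; in the other grids the ends
  must have opposite colours, so it changes by an even number. Since closing up the cycle of a strip
  gains \<open>2\<close> rows, the changes must sum to \<open>-2\<close>: wide grids drop by one row in both tall grids of
  the strip, the others drop by two rows in the tall grid that is also low.\<close>

definition exit_row :: "bool \<Rightarrow> bool \<Rightarrow> bool \<Rightarrow> int" where
  "exit_row wide left low = (if wide then 3 - of_bool left - of_bool low else 3 - 2 * of_bool low)"

definition entry_row :: "bool \<Rightarrow> bool \<Rightarrow> bool \<Rightarrow> bool \<Rightarrow> int" where
  "entry_row wide left tall low = exit_row wide left low +
     (if tall then if wide then 1 else 2 * of_bool low else 0)"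

fun path_directions :: "bool \<Rightarrow> bool \<Rightarrow> bool \<Rightarrow> bool \<Rightarrow> string" where
  "path_directions True False True _ = ''EEEEENWWWWWNEEEEEESSSSSSWNNNWWWSEESSWNWSWWNENWNE''"
| "path_directions True True True _ = ''EEEEENNNWWWWWWSEEEEESWWWWWSSSSEEEEEENNWSWNWSWWNE''"
| "path_directions True False False _ = ''NNEEEEEESSSSSWWWWWWNNESEEEENNNWWSESWWNNWS''"
| "path_directions True True False _ = ''WNNNEEEEEESSSSSWWWWWWNEEEEENNNWWWWSEEESWW''"
| "path_directions False False True False = ''NNNEEEEESSSSSSWWWWWNNESEEENWWNEENNWSWNWSS''"
| "path_directions False False True True = ''EEEENWWWWNEEEEESSSSSSWWWWWNNNEEEESSWNWSWN''"
| "path_directions False True True False = ''WNNNEEEEESSSSSSWNWSWWWNNESENEENWNENWWWSES''"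
| "path_directions False True True True = ''EEEENNWSWNWSWNWSSSSSSEEEEENNNWWWWSSEEENWW''"
| "path_directions False False False False = ''NNEEEEESSSSSWWWWWNNESEEENNNWSSWNNWS''"
| "path_directions False False False True = ''NNNEEEEESSSSSWWWWWNEEEENNNWWWSEESWW''"
| "path_directions False True False False = ''WNNESENEEESSSSSWWWWWNNESEEENNNWSSWN''"
| "path_directions False True False True = ''WNNNEEEEESSSSSWWWWWNEEEENNNWWWSEESW''"

definition rectangle_path :: "bool \<Rightarrow> bool \<Rightarrow> bool \<Rightarrow> bool \<Rightarrow> (int \<times> int) list" where
  "rectangle_path wide left tall low =
     walk (0, entry_row wide left tall low) (path_directions wide left tall low)"

lemma hd_rectangle_path:
  "hd (rectangle_path wide left tall low) = (0, entry_row wide left tall low)"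
  by (simp add: rectangle_path_def hd_walk)

lemma rectangle_path_nonempty: "rectangle_path wide left tall low \<noteq> []"
  by (simp add: rectangle_path_def walk_nonempty)

lemma
  shows distinct_rectangle_path: "distinct (rectangle_path wide left tall low)"
    and set_rectangle_path:
      "set (rectangle_path wide left tall low) = extent wide left \<times> extent tall low"
    and length_rectangle_path_ge: "3 \<le> length (rectangle_path wide left tall low)"
    and last_rectangle_path:
      "last (rectangle_path wide left tall low) = (1, exit_row wide left low)"
    and corner_edge_in_rectangle_path:
      "{(- of_bool left, - of_bool low), (1 - of_bool left, - of_bool low)} \<in>
        path_edges (rectangle_path wide left tall low)"
proof -
  have "\<forall>wide left tall low. let xs = rectangle_path wide left tall low in
      distinct xs \<and> set xs = extent wide left \<times> extent tall low \<and> 3 \<le> length xs \<and>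
      last xs = (1, exit_row wide left low) \<and>
      {(- of_bool left, - of_bool low), (1 - of_bool left, - of_bool low)} \<in> path_edges xs"
    by code_simp
  then show "distinct (rectangle_path wide left tall low)"
    "set (rectangle_path wide left tall low) = extent wide left \<times> extent tall low"
    "3 \<le> length (rectangle_path wide left tall low)"
    "last (rectangle_path wide left tall low) = (1, exit_row wide left low)"
    "{(- of_bool left, - of_bool low), (1 - of_bool left, - of_bool low)} \<in>
      path_edges (rectangle_path wide left tall low)"
    unfolding Let_def by blast+
qed

lemma middle_edges_in_rectangle_path:
  "{{(2, 2), (3, 2)}, {(2, 3), (3, 3)}} \<subseteq> path_edges (rectangle_path wide left True False)"
proof -
  have "\<forall>wide left.
      {{(2, 2), (3, 2)}, {(2, 3), (3, 3)}} \<subseteq> path_edges (rectangle_path wide left True False)"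
    by code_simp
  then show ?thesis by blast
qed

section \<open>Partition of the board into grids\<close>

context
  fixes h :: nat
  assumes h_pos: "0 < h"
begin

definition squares :: "(int \<times> int) set" where
  "squares = board (6 * (2 * h) + 2)"

definition moves :: "(int \<times> int) set set" where
  "moves = knight_edges (2 * h) (6 * (2 * h) + 2)"

lemma movesI:
  assumes "u \<in> squares" "v \<in> squares"
    and "\<bar>fst u - fst v\<bar> = 2 * int h \<and> \<bar>snd u - snd v\<bar> = 1 \<or>
      \<bar>fst u - fst v\<bar> = 1 \<and> \<bar>snd u - snd v\<bar> = 2 * int h"
  shows "{u, v} \<in> moves"
proof -
  have "{\<bar>fst u - fst v\<bar>, \<bar>snd u - snd v\<bar>} = {int (2 * h), 1}" using assms(3) by auto
  then have "{(fst u, snd u), (fst v, snd v)} \<in> moves"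
    unfolding moves_def knight_edges_def
    by (intro CollectI exI conjI refl) (use assms(1,2) in \<open>simp_all add: squares_def\<close>)
  then show ?thesis by simp
qed

definition grid_point :: "nat \<Rightarrow> nat \<Rightarrow> int \<times> int \<Rightarrow> int \<times> int" where
  "grid_point i j = (\<lambda>(X, Y).
     (2 * (int h * X + int i) + Y mod 2, 2 * (int h * Y + int j) + X mod 2))"

lemma div_with_parity_unique:
  fixes X X' :: int
  assumes "int h * X + int i = int h * X' + int i'" "X mod 2 = X' mod 2"
    and "i < 2 * h" "i' < 2 * h"
  shows "X = X' \<and> i = i'"
proof -
  have "2 dvd X - X'"
    using assms(2) by (simp add: mod_eq_dvd_iff)
  then obtain k where k: "X = X' + 2 * k"
    by (metis add.commute diff_eq_eq dvdE)
  then have "int i' = int i + int (2 * h) * k"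
    using assms(1) by (simp add: algebra_simps)
  then have "int i' mod int (2 * h) = int i mod int (2 * h)"
    by simp
  then have "i = i'"
    using assms(3,4) by simp
  then show ?thesis
    using assms(1) h_pos by simp
qed

lemma div_with_parity_exists:
  fixes n s :: int
  assumes "0 \<le> s" "s < 2"
  obtains X i where "n = int h * X + int i" "i < 2 * h" "X mod 2 = s"
proof -
  define m where "m = n - int h * s"
  have "int h * s + m = int h * (2 * (m div (2 * int h)) + s) + m mod (2 * int h)"
    using mult_div_mod_eq[of "2 * int h" m] by (simp add: algebra_simps)
  moreover have "m mod (2 * int h) = int (nat (m mod (2 * int h)))"
    using h_pos by simp
  ultimately have "n = int h * (2 * (m div (2 * int h)) + s) + int (nat (m mod (2 * int h)))"
    by (simp add: m_def)
  moreover have "nat (m mod (2 * int h)) < 2 * h"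
    using h_pos by (simp add: nat_less_iff)
  moreover have "(2 * (m div (2 * int h)) + s) mod 2 = s"
    using assms by simp
  ultimately show ?thesis by (rule that)
qed

lemma grid_point_eqD:
  assumes "grid_point i j c = grid_point i' j' c'"
    and "i < 2 * h" "j < 2 * h" "i' < 2 * h" "j' < 2 * h"
  shows "i = i' \<and> j = j' \<and> c = c'"
proof -
  obtain X Y X' Y' where c: "c = (X, Y)" "c' = (X', Y')" by fastforce
  have x: "2 * (int h * X + int i) + Y mod 2 = 2 * (int h * X' + int i') + Y' mod 2"
    and y: "2 * (int h * Y + int j) + X mod 2 = 2 * (int h * Y' + int j') + X' mod 2"
    using assms(1) unfolding grid_point_def c by simp_all
  have "Y mod 2 = Y' mod 2" "X mod 2 = X' mod 2"
    using x y by (metis mod_mult_self4 mod_mod_trivial)+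
  then show ?thesis
    using div_with_parity_unique[of X i X' i'] div_with_parity_unique[of Y j Y' j']
      x y assms(2-5) c by simp
qed

lemma grid_point_surj:
  obtains i j c where "v = grid_point i j c" "i < 2 * h" "j < 2 * h"
proof -
  obtain x y where v: "v = (x, y)" by fastforce
  obtain X i where x: "x div 2 = int h * X + int i" "i < 2 * h" "X mod 2 = y mod 2"
    using div_with_parity_exists[of "y mod 2" "x div 2"] by auto
  obtain Y j where y: "y div 2 = int h * Y + int j" "j < 2 * h" "Y mod 2 = x mod 2"
    using div_with_parity_exists[of "x mod 2" "y div 2"] by auto
  have "v = grid_point i j (X, Y)"
    unfolding v grid_point_def prod.case x(3) y(3) x(1)[symmetric] y(1)[symmetric]
    by (simp only: mult_div_mod_eq)
  then show ?thesis using that x(2) y(2) by blast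
qed

definition side :: "nat \<Rightarrow> int set" where
  "side i = extent (i mod h = 0) (h \<le> i)"

lemma in_side_iff:
  assumes "i < 2 * h"
  shows "X \<in> side i \<longleftrightarrow> 0 \<le> int h * X + int i \<and> int h * X + int i \<le> 6 * int h"
proof -
  define k I where "k = X + of_bool (h \<le> i)" and "I = int (i mod h)"
  have I: "0 \<le> I" "I < int h"
    using h_pos by (simp_all add: I_def)
  have "0 \<le> int h * k + I \<longleftrightarrow> 0 \<le> k"
    using mult_left_mono[of k "-1" "int h"] I by (cases "0 \<le> k") simp_all
  moreover have "int h * k + I \<le> 6 * int h \<longleftrightarrow> k \<le> 5 + of_bool (I = 0)"
  proof (cases "I = 0")
    case True
    then show ?thesis
      using mult_le_cancel_left_pos[of "int h" k 6] h_pos by (simp add: mult.commute)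
  next
    case False
    have "int h * k \<le> int h * 5" if "k \<le> 5"
      using that by (intro mult_left_mono) simp_all
    moreover have "int h * 6 \<le> int h * k" if "\<not> k \<le> 5"
      using that by (intro mult_left_mono) simp_all
    ultimately have "int h * k + I \<le> 6 * int h \<longleftrightarrow> k \<le> 5"
      using False I by linarith
    then show ?thesis using False by simp
  qed
  moreover have "int h * X + int i = int h * k + I"
    using assms h_pos by (auto simp: k_def I_def algebra_simps not_le mod_if)
  ultimately show ?thesis
    by (auto simp: side_def extent_def k_def I_def)
qed

lemma grid_point_in_squares_iff:
  assumes "i < 2 * h" "j < 2 * h"
  shows "grid_point i j c \<in> squares \<longleftrightarrow> c \<in> side i \<times> side j"
proof -
  obtain X Y where c: "c = (X, Y)" by fastforce
  have interval: "2 * n + Z mod 2 \<in> {0..<int (6 * (2 * h) + 2)} \<longleftrightarrow> 0 \<le> n \<and> n \<le> 6 * int h"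
    for n Z :: int by simp presburger
  show ?thesis
    unfolding c grid_point_def squares_def board_def prod.case mem_Times_iff fst_conv snd_conv
      interval in_side_iff[OF assms(1)] in_side_iff[OF assms(2)] ..
qed

lemma grid_point_step:
  assumes "grid_point i j c \<in> squares" "grid_point i j (step d c) \<in> squares"
  shows "{grid_point i j c, grid_point i j (step d c)} \<in> moves"
proof -
  obtain X Y where c: "c = (X, Y)" by fastforce
  have flip: "(n + 1) mod 2 = 1 - n mod 2" "(n - 1) mod 2 = 1 - n mod 2" for n :: int
    by presburger+
  have "X mod 2 = 0 \<or> X mod 2 = 1" "Y mod 2 = 0 \<or> Y mod 2 = 1"
    by presburger+
  then show ?thesis
    by (intro movesI[OF assms])
      (auto simp: c step_def grid_point_def flip distrib_left right_diff_distrib)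
qed

section \<open>Cycles through the grids of a strip\<close>

definition grid_path :: "nat \<Rightarrow> nat \<Rightarrow> (int \<times> int) list" where
  "grid_path i j = rectangle_path (i mod h = 0) (h \<le> i) (j mod h = 0) (h \<le> j)"

definition block :: "nat \<Rightarrow> nat \<Rightarrow> (int \<times> int) list" where
  "block i j = map (grid_point i j) (grid_path i j)"

lemma block_nonempty: "block i j \<noteq> []"
  by (simp add: block_def grid_path_def rectangle_path_nonempty)

lemma set_block: "set (block i j) = grid_point i j ` (side i \<times> side j)"
  by (simp add: block_def grid_path_def side_def set_rectangle_path)

lemma set_block_subset_squares:
  assumes "i < 2 * h" "j < 2 * h"
  shows "set (block i j) \<subseteq> squares"
  using grid_point_in_squares_iff[OF assms] by (auto simp: set_block)

lemma distinct_block: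
  assumes "i < 2 * h" "j < 2 * h"
  shows "distinct (block i j)"
  using grid_point_eqD[OF _ assms assms]
  by (auto simp: block_def grid_path_def distinct_map distinct_rectangle_path intro: inj_onI)

lemma blocks_disjoint:
  assumes "i < 2 * h" "j < 2 * h" "i' < 2 * h" "j' < 2 * h" "i \<noteq> i' \<or> j \<noteq> j'"
  shows "set (block i j) \<inter> set (block i' j') = {}"
  using grid_point_eqD[OF _ assms(1-4)] assms(5) unfolding set_block by blast

lemma path_edges_block:
  assumes "i < 2 * h" "j < 2 * h"
  shows "path_edges (block i j) \<subseteq> moves"
proof
  fix e assume e: "e \<in> path_edges (block i j)"
  then obtain c d where "e = {grid_point i j c, grid_point i j (step d c)}"
    unfolding block_def grid_path_def rectangle_path_def path_edges_map
    by (fastforce dest: path_edges_walk)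
  moreover have "e \<subseteq> squares"
    using path_edges_subset_set[OF e] set_block_subset_squares[OF assms] by blast
  ultimately show "e \<in> moves"
    using grid_point_step by simp
qed

lemma entry_row_Suc:
  assumes "Suc j < 2 * h"
  shows "entry_row wide left (Suc j mod h = 0) (h \<le> Suc j) = exit_row wide left (h \<le> j)"
proof -
  have "Suc j mod h = 0 \<longleftrightarrow> Suc j = h"
    using assms by (cases "Suc j < h") (auto simp: mod_if)
  then show ?thesis
    by (auto simp: entry_row_def exit_row_def)
qed

lemma entry_row_wrap:
  assumes "Suc j = 2 * h"
  shows "entry_row wide left (0 mod h = 0) (h \<le> 0) = exit_row wide left (h \<le> j) + 2"
  using assms h_pos by (auto simp: entry_row_def exit_row_def)

lemma block_link:
  assumes "i < 2 * h" "j < 2 * h"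
  shows "{last (block i j), hd (block i (Suc j mod (2 * h)))} \<in> moves"
proof -
  let ?next = "Suc j mod (2 * h)"
  have "?next < 2 * h" using h_pos by simp
  have "last (block i j) \<in> squares" "hd (block i ?next) \<in> squares"
    using set_block_subset_squares[OF assms] set_block_subset_squares[OF assms(1) \<open>?next < 2 * h\<close>]
      last_in_set[OF block_nonempty] hd_in_set[OF block_nonempty] by blast+
  moreover define Y where "Y = exit_row (i mod h = 0) (h \<le> i) (h \<le> j)"
  moreover have "last (block i j) = grid_point i j (1, Y)"
    using block_nonempty[of i j]
    by (simp add: block_def grid_path_def last_map last_rectangle_path Y_def)
  moreover have "hd (block i ?next) =
      (if Suc j < 2 * h then grid_point i (Suc j) (0, Y) else grid_point i 0 (0, Y + 2))"
  proof (cases "Suc j < 2 * h")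
    case True
    then show ?thesis
      using block_nonempty[of i "Suc j"]
      by (simp add: block_def grid_path_def hd_map hd_rectangle_path entry_row_Suc Y_def)
  next
    case False
    then have "Suc j = 2 * h" using assms(2) by simp
    then show ?thesis
      using block_nonempty[of i 0] entry_row_wrap[of j]
      by (simp add: block_def grid_path_def hd_map hd_rectangle_path Y_def)
  qed
  ultimately show ?thesis
    using assms(2) by (intro movesI) (auto simp: grid_point_def algebra_simps)
qed

definition strip :: "nat \<Rightarrow> (int \<times> int) set" where
  "strip i = (\<Union>j<2 * h. set (block i j))"

definition strip_cycle :: "nat \<Rightarrow> (int \<times> int) list" where
  "strip_cycle i = concat (map (block i) [0..<2 * h])"

lemma strips_disjoint:
  assumes "i < 2 * h" "i' < 2 * h" "i \<noteq> i'"
  shows "strip i \<inter> strip i' = {}"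
  using blocks_disjoint[OF assms(1) _ assms(2)] assms(3) unfolding strip_def by blast

lemma Union_strip: "(\<Union>i<2 * h. strip i) = squares"
proof (intro equalityI subsetI)
  fix v assume "v \<in> (\<Union>i<2 * h. strip i)"
  then show "v \<in> squares"
    using set_block_subset_squares unfolding strip_def by blast
next
  fix v assume v: "v \<in> squares"
  obtain i j c where "v = grid_point i j c" "i < 2 * h" "j < 2 * h"
    by (rule grid_point_surj)
  moreover from this have "c \<in> side i \<times> side j"
    using v grid_point_in_squares_iff by blast
  ultimately show "v \<in> (\<Union>i<2 * h. strip i)"
    by (auto simp: strip_def set_block)
qed

lemma hamiltonian_cycle_strip:
  assumes "i < 2 * h"
  shows "hamiltonian_cycle (strip i) moves (strip_cycle i)"
  unfolding strip_def strip_cycle_def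
proof (rule hamiltonian_cycle_concat_upt)
  show "3 \<le> length (block i 0)"
    by (simp add: block_def grid_path_def length_rectangle_path_ge)
  show "{last (block i j), hd (block i (Suc j mod (2 * h)))} \<in> moves" if "j < 2 * h" for j
    using block_link[OF assms that] .
qed (use assms h_pos in
    \<open>simp_all add: block_nonempty distinct_block blocks_disjoint path_edges_block\<close>)

lemma grid_edge_in_strip_cycle:
  assumes "{c, d} \<in> path_edges (grid_path i j)" "j < 2 * h"
  shows "{grid_point i j c, grid_point i j d} \<in> cycle_edges (strip_cycle i)"
proof -
  have "{grid_point i j c, grid_point i j d} \<in> path_edges (block i j)"
    unfolding block_def path_edges_map using assms(1) by (rule rev_image_eqI) simp
  then show ?thesis
    unfolding strip_cycle_def using h_pos assms(2)
    by (subst cycle_edges_concat_upt) (auto simp: block_nonempty)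
qed

section \<open>The tour\<close>

lemma traded_edges_in_strip_cycle:
  "{grid_point i 0 (2, 2), grid_point i 0 (3, 2)} \<in> cycle_edges (strip_cycle i)"
  "{grid_point i 0 (2, 3), grid_point i 0 (3, 3)} \<in> cycle_edges (strip_cycle i)"
  using h_pos middle_edges_in_rectangle_path
  by (simp_all add: grid_edge_in_strip_cycle grid_path_def)

lemma replacement_edges_in_moves:
  assumes "Suc i < 2 * h"
  shows "{grid_point i 0 (2, 3), grid_point (Suc i) 0 (2, 2)} \<in> moves"
    "{grid_point i 0 (3, 3), grid_point (Suc i) 0 (3, 2)} \<in> moves"
proof -
  have squares: "grid_point i' 0 (2, Y) \<in> squares" "grid_point i' 0 (3, Y) \<in> squares"
    if "i' < 2 * h" "Y = 2 \<or> Y = 3" for i' Y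
    using that h_pos by (auto simp: grid_point_in_squares_iff side_def extent_def)
  show "{grid_point i 0 (2, 3), grid_point (Suc i) 0 (2, 2)} \<in> moves"
    "{grid_point i 0 (3, 3), grid_point (Suc i) 0 (3, 2)} \<in> moves"
    using assms by (intro movesI squares; simp add: grid_point_def algebra_simps)+
qed

lemma merged_strip_cycles:
  obtains vs where "hamiltonian_cycle squares moves vs"
    and "\<And>i e v. i < 2 * h \<Longrightarrow> e \<in> cycle_edges (strip_cycle i) \<Longrightarrow> v \<in> e \<Longrightarrow> fst v < 4 * int h \<Longrightarrow>
      e \<in> cycle_edges vs"
proof -
  obtain n where n: "2 * h = Suc n"
    using h_pos by (cases "2 * h") simp_all
  let ?out = "\<lambda>i. {grid_point i 0 (2, 3), grid_point i 0 (3, 3)}"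
    and ?in = "\<lambda>i. {grid_point i 0 (2, 2), grid_point i 0 (3, 2)}"
  have "\<exists>vs. hamiltonian_cycle (\<Union>i\<le>n. strip i) moves vs \<and>
      (\<Union>i\<le>n. cycle_edges (strip_cycle i)) - (\<Union>i<n. {?out i, ?in (Suc i)}) \<subseteq> cycle_edges vs"
  proof (rule hamiltonian_cycle_merge_chain)
    show "strip i \<inter> strip j = {}" if "i < j" "j \<le> n" for i j
      using strips_disjoint[of i j] that n by simp
    show "?out i \<noteq> ?in i" for i
      using h_pos by (simp add: grid_point_def doubleton_eq_iff)
  qed (use n in \<open>simp_all add: hamiltonian_cycle_strip traded_edges_in_strip_cycle
        replacement_edges_in_moves\<close>)
  then obtain vs where vs: "hamiltonian_cycle (\<Union>i\<le>n. strip i) moves vs"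
    and keep: "(\<Union>i\<le>n. cycle_edges (strip_cycle i)) - (\<Union>i<n. {?out i, ?in (Suc i)})
      \<subseteq> cycle_edges vs"
    by blast
  have "4 * int h \<le> fst v" if "v \<in> ?out i \<union> ?in i" for i v
    using that by (auto simp: grid_point_def)
  then have untraded: "e \<notin> (\<Union>i<n. {?out i, ?in (Suc i)})" if "v \<in> e" "fst v < 4 * int h" for e v
    using that by fastforce
  show ?thesis
  proof (rule that)
    show "hamiltonian_cycle squares moves vs"
      using vs Union_strip n by (simp add: lessThan_Suc_atMost)
    show "e \<in> cycle_edges vs"
      if "i < 2 * h" "e \<in> cycle_edges (strip_cycle i)" "v \<in> e" "fst v < 4 * int h" for i e v
    proof -
      have "e \<in> (\<Union>i\<le>n. cycle_edges (strip_cycle i))"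
        using that(1,2) n by auto
      then show ?thesis
        using keep untraded[OF that(3,4)] by blast
    qed
  qed
qed

lemma corner_edge_in_strip_cycle:
  assumes "x < 2 * h" "y < 2 * h"
  shows "\<exists>i<2 * h. {(int x, int y), (int x + int (2 * h), int y + (- 1) ^ y)} \<in>
    cycle_edges (strip_cycle i)"
proof -
  define i j where "i = x div 2 + h * (y mod 2)" and "j = y div 2 + h * (x mod 2)"
  have ij: "i < 2 * h" "j < 2 * h" and shifted: "h \<le> i \<longleftrightarrow> odd y" "h \<le> j \<longleftrightarrow> odd x"
    using assms by (auto simp: i_def j_def mod_2_eq_odd)
  have "{grid_point i j (- of_bool (odd y), - of_bool (odd x)),
      grid_point i j (1 - of_bool (odd y), - of_bool (odd x))} \<in> cycle_edges (strip_cycle i)"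
    using grid_edge_in_strip_cycle[OF _ ij(2)] corner_edge_in_rectangle_path
    unfolding grid_path_def shifted[symmetric] by blast
  moreover have "grid_point i j (- of_bool (odd y), - of_bool (odd x)) = (int x, int y)"
    by (cases "even x"; cases "even y") (auto simp: grid_point_def i_def j_def elim!: evenE oddE)
  moreover have "grid_point i j (1 - of_bool (odd y), - of_bool (odd x)) =
      (int x + int (2 * h), int y + (- 1) ^ y)"
    by (cases "even x"; cases "even y") (auto simp: grid_point_def i_def j_def elim!: evenE oddE)
  ultimately show ?thesis using ij(1) by auto
qed

end

theorem theorem9:
  fixes a :: nat
  assumes "even a" and "a > 0"
  shows "\<exists>vs. knight_tour a (6 * a + 2) vs \<and> structured a vs"
proof -
  obtain h where a: "a = 2 * h" and h: "0 < h" using assms by (auto elim!: evenE)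
  obtain vs where tour: "hamiltonian_cycle (squares h) (moves h) vs"
    and keep: "\<And>i e v. i < 2 * h \<Longrightarrow> e \<in> cycle_edges (strip_cycle h i) \<Longrightarrow> v \<in> e \<Longrightarrow>
      fst v < 4 * int h \<Longrightarrow> e \<in> cycle_edges vs"
    using merged_strip_cycles[OF h] by blast
  have "structured a vs"
    unfolding structured_def
  proof (intro allI impI)
    fix x y assume "x < a" "y < a"
    then obtain i where "i < 2 * h"
      "{(int x, int y), (int x + int a, int y + (- 1) ^ y)} \<in> cycle_edges (strip_cycle h i)"
      using corner_edge_in_strip_cycle[OF h] a by blast
    then show "{(int x, int y), (int x + int a, int y + (- 1) ^ y)} \<in> cycle_edges vs"
      by (rule keep[where v = "(int x, int y)"]) (use \<open>x < a\<close> a in simp_all)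
  qed
  moreover have "knight_tour a (6 * a + 2) vs"
    using tour unfolding knight_tour_def squares_def[OF h] moves_def[OF h] a .
  ultimately show ?thesis by blast
qed

end
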